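(* Let $F$ be a field of characteristic $p>0$, and let $G$ be a finite group such that $p$ is the smallest prime dividing $|G|$. Then $$\kappa_F(G)=1-\frac1p.$$
   Context: For a field $F$, $d\ge1$ and $d\times d$ matrices $A,B$ over $F$, put $\rho_d(A,B)=\frac1d\operatorname{rank}(A-B)$. For $0<\kappa\le1$, a countable group $G$ with identity $e$ is $\kappa$-linear sofic over $F$ if for every finite set $S\subseteq G$, every $\delta>0$ and every $0\le\kappa'<\kappa$ there exist $d\ge1$ and a map $\phi:S\to\mathrm{GL}_d(F)$ such that: (AH) for all $g,h\in S$ with $gh\in S$, $\rho_d(\phi(gh),\phi(g)\phi(h))<\delta$; (D) for all $g\in S\setminus\{e\}$, $\rho_d(\phi(g),\mathrm{Id})\ge\kappa'$. Define $\kappa_F(G)$ to be the supremum of all $\kappa\in(0,1]$ such that $G$ is $\kappa$-linear sofic over $F$, and $\kappa_F(G)=0$ if there is no such $\kappa$. *)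

theory Defs
  imports
    "HOL-Computational_Algebra.Primes"
    "HOL-Algebra.Coset"
    "Jordan_Normal_Form.DL_Rank"
begin

definition rank_dist :: "nat \<Rightarrow> 'f::field mat \<Rightarrow> 'f mat \<Rightarrow> real" where
  "rank_dist d A B = real (vec_space.rank d (A - B)) / real d"

definition GL_mat :: "'f::field itself \<Rightarrow> nat \<Rightarrow> 'f mat set" where
  "GL_mat F d = {A \<in> carrier_mat d d. invertible_mat A}"

(* The field is the type 'f, passed as an itself-argument. Both notions below are meant for
   countable groups G. The restriction to S of a total function \<phi> plays the role of the map
   S \<rightarrow> GL_d(F); its values outside S are irrelevant. *)
definition linear_sofic ::
    "'f::field itself \<Rightarrow> ('g, 'm) monoid_scheme \<Rightarrow> real \<Rightarrow> bool" where
  "linear_sofic F G \<kappa> \<longleftrightarrow>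
    (\<forall>S \<delta> \<kappa>'. finite S \<longrightarrow> S \<subseteq> carrier G \<longrightarrow> \<delta> > 0 \<longrightarrow> 0 \<le> \<kappa>' \<longrightarrow> \<kappa>' < \<kappa> \<longrightarrow>
      (\<exists>d \<ge> 1. \<exists>\<phi> :: 'g \<Rightarrow> 'f mat.
        (\<forall>g \<in> S. \<phi> g \<in> GL_mat F d) \<and>
        (\<forall>g \<in> S. \<forall>h \<in> S. g \<otimes>\<^bsub>G\<^esub> h \<in> S \<longrightarrow>
            rank_dist d (\<phi> (g \<otimes>\<^bsub>G\<^esub> h)) (\<phi> g * \<phi> h) < \<delta>) \<and>
        (\<forall>g \<in> S - {\<one>\<^bsub>G\<^esub>}. rank_dist d (\<phi> g) (1\<^sub>m d) \<ge> \<kappa>')))"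

definition sofic_constant ::
    "'f::field itself \<Rightarrow> ('g, 'm) monoid_scheme \<Rightarrow> real" where
  "sofic_constant F G =
    (let K = {\<kappa>. 0 < \<kappa> \<and> \<kappa> \<le> 1 \<and> linear_sofic F G \<kappa>}
     in if K = {} then 0 else Sup K)"

end

theory Submission
  imports Defs "HOL-Algebra.Multiplicative_Group" "HOL-Algebra.Sylow"
begin

text \<open>
  The value \<open>1 - 1/p\<close> is attained by the regular representation and cannot be exceeded because
  elements of order \<open>p\<close> act almost unipotently in characteristic \<open>p\<close>.

  For the lower bound, let \<open>G\<close> act on the space with basis \<open>G\<close> by left translation. An element \<open>g\<close> of
  order \<open>m\<close> permutes the basis in cycles of length \<open>m\<close>. Modulo the column space of \<open>P g - 1\<close> all
  basis vectors in one cycle coincide, so this column space has codimension at most \<open>|G|/m\<close>, over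
  every field (\<open>rank_regular_rep_minus_one\<close>). A nontrivial \<open>g\<close> has \<open>m \<ge> p\<close>, since \<open>p\<close> is the
  smallest prime divisor of \<open>|G|\<close>; so one exact representation satisfies the conditions for all
  tolerances.

  For the upper bound, Sylow's theorem gives \<open>g \<noteq> 1\<close> with \<open>g\<^sup>p = 1\<close>. Let \<open>\<phi>\<close> be an approximate
  representation and \<open>A = \<phi> g\<close>. Adding up \<open>p\<close> errors shows that \<open>A\<^sup>p\<^sup>+\<^sup>1\<close> is close to
  \<open>\<phi> (g\<^sup>p\<^sup>+\<^sup>1) = A\<close> (\<open>rank_diff_pow_le\<close>), and cancelling the invertible \<open>A\<close> shows that
  \<open>A\<^sup>p - 1\<close> has small rank. In characteristic \<open>p\<close> this matrix is \<open>(A - 1)\<^sup>p\<close> (\<open>pow_mat_char\<close>).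
  By Sylvester's inequality (\<open>rank_sylvester\<close>) the kernel of a \<open>p\<close>-th power is at most \<open>p\<close> times as
  large as the kernel of the matrix. The kernel of \<open>(A - 1)\<^sup>p\<close> is almost everything, so the kernel
  of \<open>A - 1\<close> has dimension at least \<open>d/p\<close>, up to a small error (\<open>rank_minus_one_le\<close>). The normalized
  rank of \<open>A - 1\<close> therefore cannot exceed \<open>1 - 1/p\<close> by a fixed amount.
\<close>

section \<open>Rank inequalities for matrices over a field\<close>

lemma (in vectorspace) subspace_fin_dim:
  assumes W: "VectorSpace.subspace K W V" and fd: fin_dim
  shows "vectorspace.fin_dim K (vs W)"
proof -
  interpret W: vectorspace K "vs W" using subspace_is_vs[OF W] .
  have sub: "W \<subseteq> carrier V" "submodule K W V"
    using W by (auto simp: VectorSpace.subspace_def submodule_def)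
  have small: "finite A \<and> card A \<le> dim" if "A \<subseteq> W" "W.lin_indpt A" for A
    using that li_le_dim[OF fd] span_li_not_depend(2)[OF that(1) sub(2)] sub(1) by auto
  have "\<exists>A. finite A \<and> maximal A (\<lambda>S. S \<subseteq> carrier (vs W) \<and> W.lin_indpt S)"
    using small by (intro maximal_exists[where N = dim and B = "{}"]) (auto simp: W.lin_dep_def)
  then obtain A where "finite A" "maximal A (\<lambda>S. S \<subseteq> carrier (vs W) \<and> W.lin_indpt S)" by auto
  then have "finite A" "W.basis A" using W.max_li_is_basis by auto
  then show ?thesis unfolding W.fin_dim_def W.basis_def by auto
qed

context vec_space
begin

lemma rank_le_if_cols_in_span:
  assumes A: "A \<in> carrier_mat n nc" and B: "B \<in> carrier_mat n mc"
    and sub: "set (cols A) \<subseteq> span (set (cols B))"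
  shows "rank A \<le> rank B"
proof -
  have cA: "set (cols A) \<subseteq> carrier_vec n" and cB: "set (cols B) \<subseteq> carrier_vec n"
    using cols_dim A B by blast+
  have vsB: "VectorSpace.subspace class_ring (span (set (cols B))) V"
    and vsA: "VectorSpace.subspace class_ring (span (set (cols A))) V"
    using span_is_subspace cA cB by auto
  have le: "span (set (cols A)) \<subseteq> span (set (cols B))"
    using span_is_subset sub cB span_is_submodule by (simp add: span_subsetI)
  have nest: "VectorSpace.subspace class_ring (span (set (cols A))) (vs (span (set (cols B))))"
    by (rule nested_subspaces[OF vsB vsA le])
  show ?thesis
    unfolding rank_def
    using vectorspace.subspace_dim[OF subspace_is_vs[OF vsB] nest fin_dim_span_cols[OF B]] fin_dim_span_cols[OF A]
    by simp
qed

lemma rank_le_card_cols: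
  assumes A: "A \<in> carrier_mat n nc"
  shows "rank A \<le> card (set (cols A))"
proof -
  obtain S where S: "maximal S (\<lambda>T. T \<subseteq> set (cols A) \<and> lin_indpt T)"
    using maximal_exists[of "(\<lambda>T. T \<subseteq> set (cols A) \<and> lin_indpt T)" "card (set (cols A))" "{}"]
    by (meson List.finite_set card_mono empty_iff empty_subsetI finite_lin_indpt2 rev_finite_subset)
  then show ?thesis
    using rank_card_indpt[OF A S] by (simp add: card_mono maximal_def)
qed

lemma rank_mult_le_left:
  assumes A: "A \<in> carrier_mat n k" and B: "B \<in> carrier_mat k m"
  shows "rank (A * B) \<le> rank A"
proof (rule rank_le_if_cols_in_span)
  show "A * B \<in> carrier_mat n m" "A \<in> carrier_mat n k" using A B by auto
  show "set (cols (A * B)) \<subseteq> span (set (cols A))"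
  proof
    fix v assume "v \<in> set (cols (A * B))"
    then obtain j where j: "j < m" "v = col (A * B) j" using B by (auto simp: cols_def)
    then have "v = A *\<^sub>v col B j" using col_mult2[OF A B] by simp
    moreover have "col B j \<in> carrier_vec k" using B j by auto
    ultimately have "v \<in> col_space A"
      unfolding col_space_eq[OF A] using A by (auto intro: mult_mat_vec_carrier)
    then show "v \<in> span (set (cols A))" by (simp add: col_space_def)
  qed
qed

text \<open>Rank-nullity for \<open>A\<close> on the whole space and for \<open>A\<close> restricted to the column space of \<open>B\<close>: the
  image of the restriction is the column space of \<open>A * B\<close>, and its kernel lies in the kernel of \<open>A\<close>,
  which has dimension \<open>n - rank A\<close>.\<close>

lemma rank_sylvester:
  assumes A: "A \<in> carrier_mat n n" and B: "B \<in> carrier_mat n m"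
  shows "rank A + rank B \<le> rank (A * B) + n"
proof -
  let ?W = "span (set (cols B))"
  have cB: "set (cols B) \<subseteq> carrier_vec n" using cols_dim B by blast
  have W: "VectorSpace.subspace class_ring ?W V" using span_is_subspace cB by auto
  then have W_vs: "vectorspace class_ring (vs ?W)" by (rule subspace_is_vs)
  have Wc: "?W \<subseteq> carrier_vec n" using cB by auto
  have hom: "linear_map class_ring X V (\<lambda>v. A *\<^sub>v v)"
    if X: "vectorspace class_ring X" and sub: "carrier X \<subseteq> carrier_vec n"
      and ops: "add X = (+)" "module.smult X = (\<cdot>\<^sub>v)" for X :: "('a, 'a vec) module"
  proof -
    have "(\<lambda>v. A *\<^sub>v v) \<in> LinearCombinations.module_hom class_ring X V"
      unfolding LinearCombinations.module_hom_def
    proof (intro CollectI conjI allI impI)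
      show "(\<lambda>v. A *\<^sub>v v) \<in> carrier X \<rightarrow> carrier V"
        using mult_mat_vec_carrier[OF A] sub by (simp add: Pi_iff subset_iff)
      show "A *\<^sub>v (v \<oplus>\<^bsub>X\<^esub> w) = A *\<^sub>v v \<oplus>\<^bsub>V\<^esub> A *\<^sub>v w" if "v \<in> carrier X \<and> w \<in> carrier X" for v w
        unfolding ops using that sub mult_add_distrib_mat_vec[OF A, of v w] by (simp add: subset_iff)
      show "A *\<^sub>v (c \<odot>\<^bsub>X\<^esub> v) = c \<odot>\<^bsub>V\<^esub> (A *\<^sub>v v)" if "c \<in> carrier class_ring \<and> v \<in> carrier X" for c v
        unfolding ops using that sub mult_mat_vec[OF A, of v c] by (simp add: subset_iff)
    qed
    then show ?thesis
      by (intro linear_map.intro mod_hom.intro mod_hom_axioms.intro X vec_vs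
          vectorspace.axioms(1)[OF X] vec_module)
  qed
  have lin: "linear_map class_ring V V (\<lambda>v. A *\<^sub>v v)"
    by (rule hom[OF vec_vs]) simp_all
  have linW: "linear_map class_ring (vs ?W) V (\<lambda>v. A *\<^sub>v v)"
    by (rule hom[OF W_vs]) (simp_all add: Wc)
  interpret T: linear_map class_ring V V "\<lambda>v. A *\<^sub>v v" by (rule lin)
  interpret TW: linear_map class_ring "vs ?W" V "\<lambda>v. A *\<^sub>v v" by (rule linW)
  have im: "T.im = span (set (cols A))"
    unfolding T.im_def col_space_def[symmetric] col_space_eq[OF A] using A by auto
  have imW: "TW.im = span (set (cols (A * B)))"
  proof -
    have W_eq: "?W = {B *\<^sub>v x | x. x \<in> carrier_vec m}"
      using col_space_eq[OF B] B unfolding col_space_def by (auto intro: mult_mat_vec_carrier)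
    have "span (set (cols (A * B))) = {A *\<^sub>v (B *\<^sub>v x) | x. x \<in> carrier_vec m}"
      using col_space_eq[of "A * B" m] A B unfolding col_space_def
      by (auto simp: assoc_mult_mat_vec[OF A B] intro: mult_mat_vec_carrier)
    also have "\<dots> = (\<lambda>v. A *\<^sub>v v) ` ?W"
      unfolding W_eq by auto
    finally show ?thesis by (simp add: TW.im_def)
  qed
  have 1: "rank A + vectorspace.dim class_ring (vs T.ker) = n"
    using T.rank_nullity fin_dim dim_is_n im unfolding rank_def by simp
  have 2: "rank (A * B) + vectorspace.dim class_ring ((vs ?W)\<lparr>carrier := TW.ker\<rparr>) = rank B"
    using TW.rank_nullity fin_dim_span_cols[OF B] imW unfolding rank_def by simp
  have ker: "VectorSpace.subspace class_ring T.ker V" by (rule T.kerT_is_subspace)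
  have kerW: "VectorSpace.subspace class_ring TW.ker V"
    using TW.kerT_is_subspace W
    unfolding VectorSpace.subspace_def submodule_def by auto
  have "TW.ker \<subseteq> T.ker" using Wc by (auto simp: T.ker_def TW.ker_def)
  then have nest: "VectorSpace.subspace class_ring TW.ker (vs T.ker)"
    by (rule nested_subspaces[OF ker kerW])
  interpret K: vectorspace class_ring "vs T.ker" by (rule subspace_is_vs[OF ker])
  have fdK: "K.fin_dim" using subspace_fin_dim[OF ker] by simp
  have 3: "vectorspace.dim class_ring ((vs ?W)\<lparr>carrier := TW.ker\<rparr>) \<le> vectorspace.dim class_ring (vs T.ker)"
    using K.subspace_dim[OF nest fdK K.subspace_fin_dim[OF nest fdK]] by simp
  show ?thesis using 1 2 3 by simp
qed

text \<open>Negation is multiplication by \<open>- 1\<close> on the right, so it cannot increase the rank.\<close>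

lemma rank_minus_commute:
  assumes A: "A \<in> carrier_mat n m" and B: "B \<in> carrier_mat n m"
  shows "rank (A - B) = rank (B - A)"
proof -
  have "rank (C - D) \<le> rank (D - C)" if C: "C \<in> carrier_mat n m" and D: "D \<in> carrier_mat n m" for C D
  proof -
    have "C - D = (D - C) * (- 1\<^sub>m m)" using C D by (intro eq_matI) auto
    then show ?thesis using rank_mult_le_left[of "D - C" m "- 1\<^sub>m m" m] C D
      by (metis minus_carrier_mat one_carrier_mat uminus_carrier_iff_mat)
  qed
  then show ?thesis using A B by (simp add: le_antisym)
qed

lemma rank_one_mat: "rank (1\<^sub>m n) = n"
  using low_rank_det_zero[of "1\<^sub>m n"] by simp

text \<open>In terms of nullities: the nullity of \<open>A\<^sup>k\<close> is at most \<open>k\<close> times the nullity of \<open>A\<close>. The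
  inequality is arranged so that no subtraction of natural numbers occurs.\<close>

lemma rank_pow_ge:
  assumes A: "A \<in> carrier_mat n n"
  shows "n + k * rank A \<le> rank (A ^\<^sub>m k) + k * n"
proof (induction k)
  case 0
  then show ?case using A by (simp add: rank_one_mat)
next
  case (Suc k)
  have "rank (A ^\<^sub>m k) + rank A \<le> rank (A ^\<^sub>m Suc k) + n"
    using rank_sylvester[of "A ^\<^sub>m k" A n] A by simp
  with Suc show ?case by simp
qed

end

text \<open>The binomial theorem for the commuting matrices \<open>1\<close> and \<open>N\<close>, stated entry by entry so that the sum
  is one of scalars. The induction step is Pascal's rule.\<close>

lemma pow_mat_one_add:
  fixes N :: "'a::comm_ring_1 mat"
  assumes N: "N \<in> carrier_mat n n" and "i < n" "j < n"
  shows "((1\<^sub>m n + N) ^\<^sub>m k) $$ (i,j) = (\<Sum>l\<le>k. of_nat (k choose l) * (N ^\<^sub>m l) $$ (i,j))"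
  using assms(3)
proof (induction k arbitrary: j)
  case 0
  then show ?case using N assms by simp
next
  case (Suc k)
  let ?A = "1\<^sub>m n + N"
  have A: "?A \<in> carrier_mat n n" using N by simp
  have P: "M ^\<^sub>m l \<in> carrier_mat n n" if "M \<in> carrier_mat n n" for M :: "'a mat" and l
    using that by simp
  define c where "c l = (N ^\<^sub>m l) $$ (i,j)" for l
  have "?A ^\<^sub>m Suc k = ?A ^\<^sub>m k + ?A ^\<^sub>m k * N"
    using mult_add_distrib_mat[OF P[OF A, of k], of "1\<^sub>m n" n N] N P[OF A, of k] by simp
  then have "(?A ^\<^sub>m Suc k) $$ (i,j) = (?A ^\<^sub>m k) $$ (i,j) + (?A ^\<^sub>m k * N) $$ (i,j)"
    using Suc.prems assms N P[OF A, of k] by simp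
  also have "(?A ^\<^sub>m k * N) $$ (i,j) = (\<Sum>m<n. (?A ^\<^sub>m k) $$ (i,m) * N $$ (m,j))"
    using Suc.prems assms N P[OF A, of k] by (simp add: scalar_prod_def atLeast0LessThan)
  also have "\<dots> = (\<Sum>m<n. (\<Sum>l\<le>k. of_nat (k choose l) * (N ^\<^sub>m l) $$ (i,m)) * N $$ (m,j))"
    using Suc.IH by (intro sum.cong) auto
  also have "\<dots> = (\<Sum>l\<le>k. of_nat (k choose l) * (\<Sum>m<n. (N ^\<^sub>m l) $$ (i,m) * N $$ (m,j)))"
    unfolding sum_distrib_right sum_distrib_left
    by (subst sum.swap) (simp add: mult.assoc)
  also have "\<dots> = (\<Sum>l\<le>k. of_nat (k choose l) * c (Suc l))"
    unfolding c_def
    using Suc.prems assms N P[OF N] by (intro sum.cong) (auto simp: scalar_prod_def atLeast0LessThan)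
  also have "(?A ^\<^sub>m k) $$ (i,j) = (\<Sum>l\<le>k. of_nat (k choose l) * c l)"
    using Suc by (simp add: c_def)
  also have "(\<Sum>l\<le>k. of_nat (k choose l) * c l) + (\<Sum>l\<le>k. of_nat (k choose l) * c (Suc l))
     = (\<Sum>l\<le>Suc k. of_nat (Suc k choose l) * c l)"
  proof -
    have "(\<Sum>l\<le>k. of_nat (k choose l) * c l) = (\<Sum>l\<le>Suc k. of_nat (k choose l) * c l)" by (simp add: binomial_eq_0)
    also have "\<dots> = c 0 + (\<Sum>l\<le>k. of_nat (k choose Suc l) * c (Suc l))" by (subst sum.atMost_Suc_shift) simp
    finally show ?thesis unfolding sum.atMost_Suc_shift[of "\<lambda>l. of_nat (Suc k choose l) * c l" k] 
      by (simp add: sum.distrib algebra_simps)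
  qed
  finally show ?case by (simp add: c_def)
qed

text \<open>The inner binomial coefficients \<open>p choose l\<close> vanish in characteristic \<open>p\<close>.\<close>

lemma pow_mat_char:
  fixes A :: "'a::comm_ring_1 mat"
  assumes A: "A \<in> carrier_mat n n" and p: "prime p" "CHAR('a) = p"
  shows "(A - 1\<^sub>m n) ^\<^sub>m p = A ^\<^sub>m p - 1\<^sub>m n"
proof (rule eq_matI)
  let ?N = "A - 1\<^sub>m n"
  have N: "?N \<in> carrier_mat n n" using A by auto
  have AN: "1\<^sub>m n + ?N = A" using A by (intro eq_matI) auto
  fix i j assume ij: "i < dim_row (A ^\<^sub>m p - 1\<^sub>m n)" "j < dim_col (A ^\<^sub>m p - 1\<^sub>m n)"
  then have ij: "i < n" "j < n" by auto
  have "(A ^\<^sub>m p) $$ (i,j) = (\<Sum>l\<le>p. of_nat (p choose l) * (?N ^\<^sub>m l) $$ (i,j))"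
    using pow_mat_one_add[OF N ij] AN by simp
  also have "\<dots> = (\<Sum>l\<in>{0,p}. of_nat (p choose l) * (?N ^\<^sub>m l) $$ (i,j))"
  proof (rule sum.mono_neutral_right)
    have "of_nat (p choose l) = (0::'a)" if "l \<le> p" "l \<noteq> 0" "l \<noteq> p" for l
      using that p dvd_choose_prime[of l p] by (auto simp: of_nat_eq_0_iff_char_dvd)
    then show "\<forall>l\<in>{..p} - {0,p}. of_nat (p choose l) * (?N ^\<^sub>m l) $$ (i,j) = 0"
      by auto
  qed auto
  also have "\<dots> = (1\<^sub>m n) $$ (i,j) + (?N ^\<^sub>m p) $$ (i,j)"
    using p(1) A by (auto dest: prime_gt_0_nat)
  finally show "(?N ^\<^sub>m p) $$ (i,j) = (A ^\<^sub>m p - 1\<^sub>m n) $$ (i,j)"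
    using ij A by simp
qed (use A in auto)

text \<open>Here \<open>B i\<close> stands for the image of the \<open>i\<close>-th power of a group element under an approximate
  representation. Replacing \<open>B (i + 1)\<close> by \<open>B i * B 1\<close> costs at most \<open>r\<close>, and multiplying an earlier
  error by \<open>B 1\<close> does not increase its rank, so the errors add up. The indices start at \<open>1\<close>
  because \<open>B 0\<close> is only approximately the identity.\<close>

lemma (in vec_space) rank_diff_pow_le:
  assumes B: "\<And>i. B i \<in> carrier_mat n n"
    and r: "\<And>i. real (rank (B (Suc (Suc i)) - B (Suc i) * B 1)) \<le> r"
  shows "real (rank (B (Suc k) - B 1 ^\<^sub>m Suc k)) \<le> real k * r"
proof (induction k)
  case 0
  have "B 1 - B 1 = 0\<^sub>m n n" using B[of 1] by (intro eq_matI) auto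
  then show ?case using B[of 1] by (simp add: rank_0I)
next
  case (Suc k)
  let ?A = "B 1" and ?C = "B (Suc k)" 
  define P where "P = ?A ^\<^sub>m Suc k"
  have A: "?A \<in> carrier_mat n n" and C: "?C \<in> carrier_mat n n" and P: "P \<in> carrier_mat n n"
    using B by (auto simp: P_def simp del: pow_mat.simps)
  define X where "X = B (Suc (Suc k)) - ?C * ?A"
  define Y where "Y = ?C - P"
  have X: "X \<in> carrier_mat n n" and Y: "Y \<in> carrier_mat n n" using minus_carrier_mat[OF mult_carrier_mat[OF C A]] P by (auto simp: X_def Y_def)
  have "?A ^\<^sub>m Suc (Suc k) = P * ?A" by (simp add: P_def)
  moreover have "B (Suc (Suc k)) - P * ?A = X + Y * ?A"
    unfolding X_def Y_def minus_mult_distrib_mat[OF C P A]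
    using A C P B[of "Suc (Suc k)"] by (intro eq_matI) auto
  ultimately have "real (rank (B (Suc (Suc k)) - ?A ^\<^sub>m Suc (Suc k))) \<le> real (rank X) + real (rank (Y * ?A))"
    using rank_subadditive[OF X, of "Y * ?A"] A Y by simp
  also have "\<dots> \<le> real (rank X) + real (rank Y)"
    using rank_mult_le_left[OF Y A] by simp
  also have "\<dots> \<le> r + real k * r"
    using r[of k] Suc by (simp add: X_def Y_def P_def)
  finally show ?case by (simp add: algebra_simps)
qed

text \<open>If \<open>A\<close> is invertible and \<open>A\<^sup>p\<^sup>+\<^sup>1 = A\<close>, then \<open>A - 1\<close> is nilpotent of exponent \<open>p\<close>, hence has rank at most
  \<open>(1 - 1/p) n\<close>. The lemma is the robust form of this. Comparing \<open>A\<close> with \<open>A\<^sup>p\<^sup>+\<^sup>1\<close>, instead of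
  \<open>1\<close> with \<open>A\<^sup>p\<close>, makes it applicable to an approximate representation without first estimating
  how far the image of the identity element is from the identity matrix.\<close>

lemma (in vec_space) rank_minus_one_le:
  assumes A: "A \<in> carrier_mat n n" "invertible_mat A"
    and p: "prime p" "CHAR('a) = p"
  shows "p * rank (A - 1\<^sub>m n) \<le> (p - 1) * n + rank (A - A ^\<^sub>m Suc p)"
proof -
  obtain A' where A': "A' \<in> carrier_mat n n" "A * A' = 1\<^sub>m n"
  proof -
    obtain A' where A': "A * A' = 1\<^sub>m n" "A' * A = 1\<^sub>m (dim_row A')"
      using A by (auto simp: invertible_mat_def inverts_mat_def)
    have "dim_col A' = n" using arg_cong[OF A'(1), of dim_col] by simp
    moreover have "dim_row A' = n" using arg_cong[OF A'(2), of dim_col] A(1) by simp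
    ultimately show thesis using that A' by auto
  qed
  let ?P = "A ^\<^sub>m p"
  have P: "?P \<in> carrier_mat n n" using A by simp
  have "(A - ?P * A) * A' = A * A' - (?P * A) * A'"
    by (rule minus_mult_distrib_mat[OF A(1) mult_carrier_mat[OF P A(1)] A'(1)])
  also have "(?P * A) * A' = ?P"
    by (simp only: assoc_mult_mat[OF P A(1) A'(1)] A'(2) right_mult_one_mat[OF P])
  finally have "(A - ?P * A) * A' = 1\<^sub>m n - ?P" using A'(2) by simp
  then have "rank (?P - 1\<^sub>m n) \<le> rank (A - A ^\<^sub>m Suc p)"
    using rank_mult_le_left[OF minus_carrier_mat[OF mult_carrier_mat[OF P A(1)]] A'(1), of A] P
    by (simp add: rank_minus_commute[of ?P n "1\<^sub>m n"])
  moreover have "n + p * rank (A - 1\<^sub>m n) \<le> rank (?P - 1\<^sub>m n) + p * n"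
    using rank_pow_ge[OF minus_carrier_mat[OF one_carrier_mat], of p A] by (simp add: pow_mat_char[OF A(1) p])
  moreover have "p * n = n + (p - 1) * n" using prime_gt_0_nat[OF p(1)] by (cases p) auto
  ultimately show ?thesis by simp
qed

section \<open>The upper bound\<close>

lemma (in group) exists_prime_order_element:
  assumes fin: "finite (carrier G)" and p: "prime p" "p dvd Coset.order G"
  shows "\<exists>g\<in>carrier G. g \<noteq> \<one> \<and> g [^] p = \<one>"
proof -
  obtain m where "Coset.order G = p ^ 1 * m" using p(2) by auto
  then obtain H where H: "subgroup H G" "card H = p"
    using sylow_thm[OF p(1) is_group _ fin, of 1 m] by auto
  have "card H > 1" using H(2) prime_gt_1_nat[OF p(1)] by simp
  then obtain g where g: "g \<in> H" "g \<noteq> \<one>"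
  proof -
    have "H \<noteq> {\<one>}" using \<open>card H > 1\<close> by auto
    then show thesis using that subgroup.one_closed[OF H(1)] by blast
  qed
  interpret K: group "G\<lparr>carrier := H\<rparr>" by (rule subgroup.subgroup_is_group[OF H(1) is_group])
  have "g [^] p = \<one>"
    using K.pow_order_eq_1[of g] g H by (simp add: Coset.order_def nat_pow_consistent[symmetric])
  then show ?thesis using g H subgroup.mem_carrier by metis
qed

text \<open>Apply soficity to \<open>S = G\<close> and to some \<open>\<kappa>'\<close> strictly between \<open>1 - 1/p\<close> and \<open>\<kappa>\<close>. For an element
  of order \<open>p\<close> the estimates above give \<open>\<kappa>' \<le> 1 - 1/p + \<delta>\<close>.\<close>

lemma linear_sofic_le:
  fixes G :: "('g, 'm) monoid_scheme"
  assumes "group G" and fin: "finite (carrier G)"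
    and p: "prime p" "CHAR('f::field) = p" "p dvd Coset.order G"
    and ls: "linear_sofic TYPE('f) G \<kappa>"
  shows "\<kappa> \<le> 1 - 1 / real p"
proof (rule ccontr)
  assume less: "\<not> \<kappa> \<le> 1 - 1 / real p"
  interpret group G by fact
  obtain g where g: "g \<in> carrier G" "g \<noteq> \<one>\<^bsub>G\<^esub>" "g [^]\<^bsub>G\<^esub> p = \<one>\<^bsub>G\<^esub>"
    using exists_prime_order_element[OF fin p(1,3)] by auto
  have p2: "real p \<ge> 2" using prime_ge_2_nat[OF p(1)] by simp
  obtain \<kappa>' where k: "1 - 1 / real p < \<kappa>'" "\<kappa>' < \<kappa>" using less dense by (metis not_le)
  have k0: "0 \<le> \<kappa>'" using k(1) p2 by (smt (verit) divide_le_eq_1)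
  \<comment> \<open>The accumulated error \<open>p \<delta>\<close> is divided by \<open>p\<close> again, so half of the gap is small enough.\<close>
  define \<delta> where "\<delta> = (\<kappa>' - (1 - 1 / real p)) / 2"
  have d0: "\<delta> > 0" using k by (simp add: \<delta>_def)
  have "\<exists>d\<ge>1. \<exists>\<phi> :: 'g \<Rightarrow> 'f mat.
        (\<forall>g \<in> carrier G. \<phi> g \<in> GL_mat TYPE('f) d) \<and>
        (\<forall>g \<in> carrier G. \<forall>h \<in> carrier G. g \<otimes>\<^bsub>G\<^esub> h \<in> carrier G \<longrightarrow>
            rank_dist d (\<phi> (g \<otimes>\<^bsub>G\<^esub> h)) (\<phi> g * \<phi> h) < \<delta>) \<and>
        (\<forall>g \<in> carrier G - {\<one>\<^bsub>G\<^esub>}. rank_dist d (\<phi> g) (1\<^sub>m d) \<ge> \<kappa>')"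
    using ls fin d0 k0 k(2) unfolding linear_sofic_def by blast
  then obtain d and \<phi> :: "'g \<Rightarrow> 'f mat" where d: "d \<ge> 1"
    and GL: "\<And>g. g \<in> carrier G \<Longrightarrow> \<phi> g \<in> GL_mat TYPE('f) d"
    and AH: "\<And>g h. g \<in> carrier G \<Longrightarrow> h \<in> carrier G \<Longrightarrow> rank_dist d (\<phi> (g \<otimes>\<^bsub>G\<^esub> h)) (\<phi> g * \<phi> h) < \<delta>"
    and D: "rank_dist d (\<phi> g) (1\<^sub>m d) \<ge> \<kappa>'"
    using g by (metis (no_types, lifting) DiffI singletonD m_closed)
  interpret V: vec_space "TYPE('f)" d .
  define B where "B i = \<phi> (g [^]\<^bsub>G\<^esub> (i::nat))" for i
  have B: "B i \<in> carrier_mat d d" for i using GL g by (simp add: B_def GL_mat_def)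
  have B1: "B 1 = \<phi> g" "B (Suc p) = \<phi> g" using g by (simp_all add: B_def)
  have "real (V.rank (B (Suc (Suc i)) - B (Suc i) * B 1)) \<le> \<delta> * d" for i
    using AH[of "g [^]\<^bsub>G\<^esub> Suc i" g] g d by (simp add: B_def rank_dist_def field_simps)
  then have "real (V.rank (B (Suc p) - B 1 ^\<^sub>m Suc p)) \<le> real p * (\<delta> * d)"
    by (rule V.rank_diff_pow_le[OF B])
  then have error: "real (V.rank (\<phi> g - \<phi> g ^\<^sub>m Suc p)) \<le> real p * (\<delta> * d)" unfolding B1 .
  have "\<phi> g \<in> carrier_mat d d" "invertible_mat (\<phi> g)" using GL g by (auto simp: GL_mat_def)
  then have "p * V.rank (\<phi> g - 1\<^sub>m d) \<le> (p - 1) * d + V.rank (\<phi> g - \<phi> g ^\<^sub>m Suc p)"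
    by (rule V.rank_minus_one_le[OF _ _ p(1,2)])
  then have "real (p * V.rank (\<phi> g - 1\<^sub>m d)) \<le> real ((p - 1) * d + V.rank (\<phi> g - \<phi> g ^\<^sub>m Suc p))"
    by (simp only: of_nat_le_iff)
  then have "real p * real (V.rank (\<phi> g - 1\<^sub>m d)) \<le> (real p - 1) * d + real (V.rank (\<phi> g - \<phi> g ^\<^sub>m Suc p))"
    using prime_gt_0_nat[OF p(1)] by (simp add: of_nat_diff Suc_le_eq del: pow_mat.simps)
  moreover have "\<kappa>' * d \<le> V.rank (\<phi> g - 1\<^sub>m d)" using D d by (simp add: rank_dist_def field_simps)
  then have "real p * (\<kappa>' * d) \<le> real p * V.rank (\<phi> g - 1\<^sub>m d)" by (rule mult_left_mono) simp
  ultimately have "real p * (\<kappa>' * d) \<le> (real p - 1) * d + real p * (\<delta> * d)" using error by linarith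
  then have "real d * (real p * \<kappa>') \<le> real d * (real p - 1 + real p * \<delta>)" by (simp add: algebra_simps)
  then have "real p * \<kappa>' \<le> real p - 1 + real p * \<delta>" using d by simp
  moreover have "2 * (real p * \<delta>) = real p * \<kappa>' - (real p - 1)"
    using p2 by (simp add: \<delta>_def field_simps)
  moreover have "0 < real p * \<delta>" using d0 p2 by simp
  ultimately show False by linarith
qed

section \<open>The regular representation and the lower bound\<close>

text \<open>The permutation matrix of left translation by \<open>g\<close>, where \<open>f\<close> enumerates the group: column \<open>j\<close>
  is the unit vector at the index of \<open>g \<otimes> f j\<close>.\<close>

definition regular_rep :: "('g, 'm) monoid_scheme \<Rightarrow> (nat \<Rightarrow> 'g) \<Rightarrow> 'g \<Rightarrow> 'f::field mat" where
  "regular_rep G f g =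
    mat (Coset.order G) (Coset.order G) (\<lambda>(i, j). if f i = g \<otimes>\<^bsub>G\<^esub> f j then 1 else 0)"

lemma regular_rep_carrier [simp]: "regular_rep G f g \<in> carrier_mat (Coset.order G) (Coset.order G)"
  
  and dim_regular_rep [simp]: "dim_row (regular_rep G f g) = Coset.order G"
    "dim_col (regular_rep G f g) = Coset.order G"
  by (simp_all add: regular_rep_def)

context group
begin

lemma regular_rep_one:
  assumes f: "bij_betw f {..<Coset.order G} (carrier G)"
  shows "regular_rep G f \<one> = 1\<^sub>m (Coset.order G)"
proof -
  have "f i = \<one> \<otimes> f j \<longleftrightarrow> i = j" if "i < Coset.order G" "j < Coset.order G" for i j
  proof -
    have "f j \<in> carrier G" using f that(2) by (auto simp: bij_betw_def)
    moreover have "f i = f j \<longleftrightarrow> i = j"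
      using f that by (auto simp: bij_betw_def dest: inj_onD)
    ultimately show ?thesis by simp
  qed
  then show ?thesis unfolding regular_rep_def by (intro eq_matI) auto
qed

lemma regular_rep_mult:
  assumes f: "bij_betw f {..<Coset.order G} (carrier G)"
    and g: "g \<in> carrier G" and h: "h \<in> carrier G"
  shows "regular_rep G f g * regular_rep G f h = regular_rep G f (g \<otimes> h)"
proof (rule eq_matI)
  let ?n = "Coset.order G"
  fix i j assume "i < dim_row (regular_rep G f (g \<otimes> h))" "j < dim_col (regular_rep G f (g \<otimes> h))"
  then have ij: "i < ?n" "j < ?n" by (auto simp: regular_rep_def)
  have fc: "f k \<in> carrier G" if "k < ?n" for k using f that by (auto simp: bij_betw_def)
  obtain k where k: "k < ?n" "f k = h \<otimes> f j"
    using f fc[OF ij(2)] h by (metis bij_betw_imp_surj_on image_iff lessThan_iff m_closed)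
  have kk: "f l = h \<otimes> f j \<longleftrightarrow> l = k" if "l < ?n" for l
    using that k f unfolding bij_betw_def by (metis inj_on_def lessThan_iff)
  have "(regular_rep G f g * regular_rep G f h) $$ (i, j)
    = (\<Sum>l<?n. (if f i = g \<otimes> f l then 1 else 0) * (if f l = h \<otimes> f j then 1 else 0))"
    using ij by (simp add: regular_rep_def scalar_prod_def atLeast0LessThan)
  also have "\<dots> = (\<Sum>l<?n. if l = k then (if f i = g \<otimes> f l then 1 else 0) else 0)"
    by (intro sum.cong) (auto simp: kk)
  also have "\<dots> = (if f i = g \<otimes> (h \<otimes> f j) then 1 else 0)" using k by simp
  finally show "(regular_rep G f g * regular_rep G f h) $$ (i, j) = regular_rep G f (g \<otimes> h) $$ (i, j)"
    using ij g h fc by (simp add: regular_rep_def m_assoc)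
qed (auto simp: regular_rep_def)

lemma regular_rep_GL:
  assumes f: "bij_betw f {..<Coset.order G} (carrier G)" and g: "g \<in> carrier G"
  shows "(regular_rep G f g :: 'f::field mat) \<in> GL_mat TYPE('f) (Coset.order G)"
proof -
  have "regular_rep G f h * regular_rep G f (inv h) = (1\<^sub>m (Coset.order G) :: 'f mat)"
    if "h \<in> carrier G" for h
    using that by (simp add: regular_rep_mult[OF f] regular_rep_one[OF f])
  from this[of g] this[of "inv g"]
  have "inverts_mat (regular_rep G f g :: 'f mat) (regular_rep G f (inv g))"
    and "inverts_mat (regular_rep G f (inv g)) (regular_rep G f g :: 'f mat)"
    using g by (simp_all add: inverts_mat_def)
  then show ?thesis
    using regular_rep_carrier[of G f g] by (auto simp: GL_mat_def invertible_mat_def)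
qed

text \<open>A function \<open>t\<close> that picks one representative in each right coset of \<open>H\<close> takes as many values
  as there are cosets, and Lagrange's theorem counts these.\<close>

lemma card_coset_representatives:
  assumes fin: "finite (carrier G)" and H: "subgroup H G"
  shows "\<exists>t. (\<forall>x\<in>carrier G. t x \<in> H #> x) \<and> card (t ` carrier G) * card H \<le> Coset.order G"
proof (intro exI conjI ballI)
  let ?t = "\<lambda>x. SOME y. y \<in> H #> x"
  show "?t x \<in> H #> x" if "x \<in> carrier G" for x
    using rcos_self[OF that H] by (rule someI)
  have "?t ` carrier G = (\<lambda>C. SOME y. y \<in> C) ` (rcosets H)"
    by (auto simp: RCOSETS_def image_image)
  moreover have "finite (rcosets H)" using fin by (auto simp: RCOSETS_def)
  ultimately have "card (?t ` carrier G) \<le> card (rcosets H)" by (simp add: card_image_le)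
  then show "card (?t ` carrier G) * card H \<le> Coset.order G"
    using lagrange[OF H] by (metis mult_le_mono1)
qed

text \<open>Division by \<open>ord g\<close> gives \<open>rank (P g - 1) \<ge> |G| (1 - 1 / ord g)\<close>. Write \<open>e x\<close> for the basis vector
  at \<open>x\<close>. The columns of \<open>P g - 1\<close> are the vectors \<open>e (g x) - e x\<close>, so by telescoping their span \<open>S\<close>
  contains \<open>e (h x) - e x\<close> for all powers \<open>h\<close> of \<open>g\<close>. Let \<open>E\<close> be the matrix that sends every basis
  vector to the one at the chosen representative of its orbit. Then \<open>E - 1\<close> has its columns in \<open>S\<close>,
  and \<open>E\<close> has at most \<open>|G| / ord g\<close> different columns. Subadditivity of the rank for
  \<open>1 = E + (1 - E)\<close> gives the claim.\<close>

lemma rank_regular_rep_minus_one: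
  assumes fin: "finite (carrier G)" and f: "bij_betw f {..<Coset.order G} (carrier G)"
    and g: "g \<in> carrier G"
  shows "Coset.order G * ord g \<le> Coset.order G +
    ord g * vec_space.rank (Coset.order G) (regular_rep G f g - 1\<^sub>m (Coset.order G) :: 'f::field mat)"
proof -
  define n where "n = Coset.order G"
  interpret V: vec_space "TYPE('f)" n .
  define N :: "'f mat" where "N = regular_rep G f g - 1\<^sub>m n"
  have N: "N \<in> carrier_mat n n" unfolding N_def by (rule minus_carrier_mat) simp
  define S where "S = V.span (set (cols N))"
  have cN: "set (cols N) \<subseteq> carrier_vec n" using N cols_dim by blast
  define e :: "'a \<Rightarrow> 'f vec" where "e x = vec n (\<lambda>i. if f i = x then 1 else 0)" for x
  have fc: "f k \<in> carrier G" if "k < n" for k using f that by (auto simp: bij_betw_def n_def)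
  have col_N: "col N j = e (g \<otimes> f j) - e (f j)" if j: "j < n" for j
  proof (rule eq_vecI)
    have "f i = f j \<longleftrightarrow> i = j" if "i < n" for i
      using f j that by (auto simp: bij_betw_def inj_on_def n_def)
    then show "col N j $ i = (e (g \<otimes> f j) - e (f j)) $ i" if "i < dim_vec (e (g \<otimes> f j) - e (f j))" for i
      using that j by (simp add: N_def regular_rep_def e_def n_def)
  qed (simp add: N_def e_def)
  have step: "e (g \<otimes> x) - e x \<in> S" if x: "x \<in> carrier G" for x
  proof -
    obtain j where "j < n" "x = f j" using f x unfolding n_def bij_betw_def by blast
    then have "e (g \<otimes> x) - e x \<in> set (cols N)"
      using col_N N by (metis carrier_matD(2) cols_length cols_nth nth_mem)
    then show ?thesis unfolding S_def using V.in_own_span cN by auto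
  qed
  have telescope: "e (g [^] k \<otimes> x) - e x \<in> S" if x: "x \<in> carrier G" for x and k :: nat
  proof (induction k)
    case 0
    have "e x - e x = 0\<^sub>v n" by (simp add: e_def)
    moreover have "0\<^sub>v n \<in> S"
      using submodule.zero_closed[OF V.span_is_submodule[of "set (cols N)"]] cN by (simp add: S_def)
    ultimately show ?case using x by simp
  next
    case (Suc k)
    let ?y = "g [^] k \<otimes> x"
    have y: "?y \<in> carrier G" using x g by simp
    have "(e (g \<otimes> ?y) - e ?y) + (e ?y - e x) \<in> S"
      using V.span_add1[OF _ step[OF y, unfolded S_def] Suc[unfolded S_def]] cN by (simp add: S_def)
    moreover have "(e (g \<otimes> ?y) - e ?y) + (e ?y - e x) = e (g \<otimes> ?y) - e x"
      by (intro eq_vecI) (auto simp: e_def)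
    moreover have "g \<otimes> ?y = g [^] Suc k \<otimes> x"
      using g x nat_pow_Suc2 by (simp add: m_assoc)
    ultimately show ?case by simp
  qed
  let ?H = "generate G {g}"
  have H: "subgroup ?H G" using generate_is_subgroup[of "{g}"] g by simp
  obtain t where t: "\<And>x. x \<in> carrier G \<Longrightarrow> t x \<in> ?H #> x"
    and card_t: "card (t ` carrier G) * ord g \<le> n"
    using card_coset_representatives[OF fin H] generate_pow_card[OF g] by (auto simp: n_def)
  have t_diff: "e (t x) - e x \<in> S" if x: "x \<in> carrier G" for x
  proof -
    obtain h where "h \<in> ?H" "t x = h \<otimes> x" using t[OF x] by (auto simp: r_coset_def)
    moreover have "?H = {g [^] k | k. k \<in> (UNIV :: nat set)}"
      using generate_pow_nat[OF g] ord_ge_1[OF fin g] by simp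
    ultimately show ?thesis using telescope[OF x] by auto
  qed
  define E :: "'f mat" where "E = mat n n (\<lambda>(i, j). if f i = t (f j) then 1 else 0)"
  have E: "E \<in> carrier_mat n n" by (simp add: E_def)
  have col_E: "col E j = e (t (f j))" if "j < n" for j
    using that by (intro eq_vecI) (auto simp: E_def e_def)
  have "set (cols E) \<subseteq> e ` t ` carrier G"
    using col_E fc E by (auto simp: cols_def)
  then have "card (set (cols E)) \<le> card (e ` t ` carrier G)" using fin by (intro card_mono) auto
  also have "\<dots> \<le> card (t ` carrier G)" using fin by (intro card_image_le) auto
  finally have rank_E: "V.rank E \<le> card (t ` carrier G)"
    using V.rank_le_card_cols[OF E] by simp
  have "set (cols (E - 1\<^sub>m n)) \<subseteq> S"
  proof
    fix v assume "v \<in> set (cols (E - 1\<^sub>m n))"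
    then obtain j where j: "j < n" "v = col (E - 1\<^sub>m n) j" by (auto simp: cols_def)
    have "f i = f j \<longleftrightarrow> i = j" if "i < n" for i
      using f j that by (auto simp: bij_betw_def inj_on_def n_def)
    then have "v = e (t (f j)) - e (f j)"
      using j by (intro eq_vecI) (auto simp: E_def e_def)
    then show "v \<in> S" using t_diff fc j by simp
  qed
  then have "V.rank (E - 1\<^sub>m n) \<le> V.rank N"
    using V.rank_le_if_cols_in_span[OF minus_carrier_mat[OF one_carrier_mat] N] by (simp add: S_def)
  moreover have "E + (1\<^sub>m n - E) = 1\<^sub>m n" using E by (intro eq_matI) auto
  then have "n \<le> V.rank E + V.rank (E - 1\<^sub>m n)"
    using V.rank_subadditive[OF E minus_carrier_mat[OF E], of "1\<^sub>m n"] V.rank_one_mat V.rank_minus_commute[OF E, of "1\<^sub>m n"] by simp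
  ultimately have "n \<le> card (t ` carrier G) + V.rank N" using rank_E by simp
  then have "n * ord g \<le> card (t ` carrier G) * ord g + ord g * V.rank N"
    by (metis add_mult_distrib mult.commute mult_le_mono1)
  then show ?thesis using card_t unfolding n_def N_def by simp
qed

lemma ord_ge_smallest_prime:
  assumes fin: "finite (carrier G)"
    and smallest: "\<And>q::nat. prime q \<Longrightarrow> q dvd Coset.order G \<Longrightarrow> p \<le> q"
    and g: "g \<in> carrier G" "g \<noteq> \<one>"
  shows "p \<le> ord g"
proof -
  have "ord g \<noteq> 1" using g ord_eq_1 by simp
  then obtain q where q: "prime q" "q dvd ord g" using prime_factor_nat by blast
  then have "q dvd Coset.order G" using ord_dvd_group_order[OF g(1)] dvd_trans by blast
  then have "p \<le> q" using smallest q by simp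
  also have "q \<le> ord g" using q(2) ord_ge_1[OF fin g(1)] by (simp add: dvd_imp_le)
  finally show ?thesis .
qed

end

text \<open>The regular representation is an exact homomorphism, so one and the same map serves for all \<open>S\<close>,
  \<open>\<delta>\<close> and \<open>\<kappa>'\<close>.\<close>

lemma linear_sofic_regular_rep:
  fixes G :: "('g, 'm) monoid_scheme"
  assumes "group G" and fin: "finite (carrier G)"
    and p: "p > 0" and smallest: "\<And>q::nat. prime q \<Longrightarrow> q dvd Coset.order G \<Longrightarrow> p \<le> q"
  shows "linear_sofic TYPE('f::field) G (1 - 1 / real p)"
proof -
  interpret group G by fact
  define n where "n = Coset.order G"
  have n: "n \<ge> 1" using fin order_gt_0_iff_finite by (simp add: n_def Suc_le_eq)
  obtain f where f: "bij_betw f {..<n} (carrier G)"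
    using ex_bij_betw_nat_finite[OF fin] by (auto simp: n_def Coset.order_def atLeast0LessThan)
  interpret V: vec_space "TYPE('f)" n .
  let ?\<phi> = "regular_rep G f :: 'g \<Rightarrow> 'f mat"
  have hom: "rank_dist n (?\<phi> (g \<otimes>\<^bsub>G\<^esub> h)) (?\<phi> g * ?\<phi> h) = 0" if "g \<in> carrier G" "h \<in> carrier G" for g h
  proof -
    have "?\<phi> (g \<otimes>\<^bsub>G\<^esub> h) - ?\<phi> g * ?\<phi> h = 0\<^sub>m n n"
      using that by (simp add: n_def regular_rep_mult[OF f[unfolded n_def]] minus_r_inv_mat[OF regular_rep_carrier])
    then show ?thesis by (simp add: rank_dist_def V.rank_0I)
  qed
  have far: "rank_dist n (?\<phi> g) (1\<^sub>m n) \<ge> 1 - 1 / real p" if g: "g \<in> carrier G" "g \<noteq> \<one>\<^bsub>G\<^esub>" for g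
  proof -
    have po: "p \<le> ord g" by (rule ord_ge_smallest_prime[OF fin smallest g])
    define r where "r = V.rank (?\<phi> g - 1\<^sub>m n)"
    have "n * ord g \<le> n + ord g * r"
      using rank_regular_rep_minus_one[OF fin f[unfolded n_def] g(1), where 'f = 'f] by (simp add: n_def r_def)
    then have "real n * ord g \<le> n + ord g * real r"
      by (metis of_nat_add of_nat_le_iff of_nat_mult)
    then have "1 - 1 / ord g \<le> r / n" using n p po by (simp add: field_simps)
    moreover have "1 / ord g \<le> 1 / real p" using p po by (simp add: frac_le)
    ultimately show ?thesis by (simp add: rank_dist_def r_def)
  qed
  show ?thesis unfolding linear_sofic_def
  proof (intro allI impI)
    fix S :: "'g set" and \<delta> \<kappa>' :: real
    assume S: "S \<subseteq> carrier G" and \<delta>: "\<delta> > 0" and k: "\<kappa>' < 1 - 1 / real p"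
    have "\<forall>g\<in>S. ?\<phi> g \<in> GL_mat TYPE('f) n"
      using regular_rep_GL[OF f[unfolded n_def]] S by (auto simp: n_def)
    moreover have "\<forall>g\<in>S. \<forall>h\<in>S. g \<otimes>\<^bsub>G\<^esub> h \<in> S \<longrightarrow>
        rank_dist n (?\<phi> (g \<otimes>\<^bsub>G\<^esub> h)) (?\<phi> g * ?\<phi> h) < \<delta>"
      using hom S \<delta> by (simp add: subset_iff)
    moreover have "\<forall>g\<in>S - {\<one>\<^bsub>G\<^esub>}. rank_dist n (?\<phi> g) (1\<^sub>m n) \<ge> \<kappa>'"
    proof
      fix g assume "g \<in> S - {\<one>\<^bsub>G\<^esub>}"
      then show "rank_dist n (?\<phi> g) (1\<^sub>m n) \<ge> \<kappa>'" using far[of g] S k by auto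
    qed
    ultimately show "\<exists>d\<ge>1. \<exists>\<phi> :: 'g \<Rightarrow> 'f mat.
        (\<forall>g\<in>S. \<phi> g \<in> GL_mat TYPE('f) d) \<and>
        (\<forall>g\<in>S. \<forall>h\<in>S. g \<otimes>\<^bsub>G\<^esub> h \<in> S \<longrightarrow>
            rank_dist d (\<phi> (g \<otimes>\<^bsub>G\<^esub> h)) (\<phi> g * \<phi> h) < \<delta>) \<and>
        (\<forall>g\<in>S - {\<one>\<^bsub>G\<^esub>}. rank_dist d (\<phi> g) (1\<^sub>m d) \<ge> \<kappa>')"
      using n by (intro exI[of _ n] exI[of _ ?\<phi>] conjI)
  qed
qed

section \<open>The sofic constant\<close>

theorem theorem3:
  fixes G :: "('g, 'm) monoid_scheme" and p :: nat
  assumes "CHAR('f::field) = p" and "p > 0"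
    and "group G" and "finite (carrier G)"
    and "prime p" and "p dvd Coset.order G"
    and "\<And>q::nat. prime q \<Longrightarrow> q dvd Coset.order G \<Longrightarrow> p \<le> q"
  shows "sofic_constant TYPE('f) G = 1 - 1 / real p"
proof -
  let ?K = "{\<kappa>. 0 < \<kappa> \<and> \<kappa> \<le> 1 \<and> linear_sofic TYPE('f) G \<kappa>}"
  have "real p \<ge> 2" using prime_ge_2_nat[OF \<open>prime p\<close>] by simp
  then have "1 - 1 / real p \<in> ?K"
    using linear_sofic_regular_rep[OF assms(3,4,2,7)] by simp
  moreover have "\<kappa> \<le> 1 - 1 / real p" if "\<kappa> \<in> ?K" for \<kappa>
    using linear_sofic_le[OF assms(3,4,5,1,6)] that by blast
  ultimately have "?K \<noteq> {}" "Sup ?K = 1 - 1 / real p"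
    by (blast, intro cSup_eq_maximum)
  then show ?thesis unfolding sofic_constant_def Let_def by presburger
qed

end
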